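(* Let $K(x,y)=\Phi(x-y)$ be a kernel on $\mathbb{R}^d$ whose Fourier transform decays at least exponentially, i.e. there are constants $C,c>0$ with $|\hat\Phi(\omega)|\le C\exp(-c\|\omega\|_2)$ for all $\omega\in\mathbb{R}^d$. Then the native space of $K$ contains no nonzero compactly supported function.
   Context: $K$ is a continuous symmetric positive definite translation-invariant real-valued kernel on $\mathbb{R}^d\times\mathbb{R}^d$, written $K(x,y)=\Phi(x-y)$, and $\hat\Phi$ is the $d$-variate Fourier transform of $\Phi$. The native space of $K$ is the Hilbert space of functions on $\mathbb{R}^d$ for which $K$ is the reproducing kernel. *)

theory Defs
  imports "HOL-Analysis.Analysis"
begin

text \<open>The weak form of positive definiteness: repeated points are excluded by summing over a set,
  and strictness of the inequality is not demanded. Kernels with strictly positive definite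
  matrices are included.\<close>

definition positive_definite_kernel :: "('a \<Rightarrow> 'a \<Rightarrow> real) \<Rightarrow> bool" where
  "positive_definite_kernel K \<longleftrightarrow>
     (\<forall>X a. finite X \<longrightarrow> (\<Sum>x\<in>X. \<Sum>y\<in>X. a x * a y * K x y) \<ge> 0)"

definition hilbert_function_space ::
    "('a \<Rightarrow> real) set \<Rightarrow> (('a \<Rightarrow> real) \<Rightarrow> ('a \<Rightarrow> real) \<Rightarrow> real) \<Rightarrow> bool" where
  "hilbert_function_space H ip \<longleftrightarrow>
     (\<lambda>x. 0) \<in> H \<and>
     (\<forall>f\<in>H. \<forall>g\<in>H. (\<lambda>x. f x + g x) \<in> H) \<and>
     (\<forall>r. \<forall>f\<in>H. (\<lambda>x. r * f x) \<in> H) \<and>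
     (\<forall>f\<in>H. \<forall>g\<in>H. ip f g = ip g f) \<and>
     (\<forall>f\<in>H. \<forall>g\<in>H. \<forall>h\<in>H. ip (\<lambda>x. f x + g x) h = ip f h + ip g h) \<and>
     (\<forall>r. \<forall>f\<in>H. \<forall>g\<in>H. ip (\<lambda>x. r * f x) g = r * ip f g) \<and>
     (\<forall>f\<in>H. f \<noteq> (\<lambda>x. 0) \<longrightarrow> ip f f > 0) \<and>
     Metric_space.mcomplete H (\<lambda>f g. sqrt (ip (\<lambda>x. f x - g x) (\<lambda>x. f x - g x)))"

text \<open>By the Moore--Aronszajn theorem, a positive definite \<open>K\<close> determines the pair \<open>H\<close> and \<open>ip\<close>
  (on \<open>H\<close>) uniquely.\<close>

definition native_space ::
    "('a \<Rightarrow> 'a \<Rightarrow> real) \<Rightarrow> ('a \<Rightarrow> real) set \<Rightarrow> (('a \<Rightarrow> real) \<Rightarrow> ('a \<Rightarrow> real) \<Rightarrow> real) \<Rightarrow> bool" where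
  "native_space K H ip \<longleftrightarrow>
     hilbert_function_space H ip \<and>
     (\<forall>y. (\<lambda>x. K x y) \<in> H) \<and>
     (\<forall>f\<in>H. \<forall>y. ip f (\<lambda>x. K x y) = f y)"

fun iterated_partial :: "'n list \<Rightarrow> (real ^ 'n \<Rightarrow> complex) \<Rightarrow> real ^ 'n \<Rightarrow> complex" where
  "iterated_partial [] g = g"
| "iterated_partial (i # is) g =
     (\<lambda>x. frechet_derivative (iterated_partial is g) (at x) (axis i 1))"

definition schwartz_function :: "(real ^ 'n \<Rightarrow> complex) \<Rightarrow> bool" where
  "schwartz_function g \<longleftrightarrow>
     (\<forall>is. iterated_partial is g differentiable_on UNIV) \<and>
     (\<forall>is k. bounded (range (\<lambda>x. norm x ^ k *\<^sub>R iterated_partial is g x)))"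

definition fourier_integral :: "(real ^ 'n \<Rightarrow> complex) \<Rightarrow> real ^ 'n \<Rightarrow> complex" where
  "fourier_integral g \<omega> =
     (2 * pi) powr (- real CARD('n) / 2) *\<^sub>R
     (LINT x|lborel. g x * exp (- \<i> * complex_of_real (x \<bullet> \<omega>)))"

text \<open>The function \<open>G\<close> is the Fourier transform of \<open>F\<close> in the sense of tempered distributions. For
  integrable \<open>F\<close>, Fubini's theorem makes \<open>fourier_integral F\<close> such a \<open>G\<close>, unique up to null sets;
  the distributional definition also covers non-integrable \<open>F\<close> (such as sinc), for which
  \<open>fourier_integral F\<close> is a meaningless default value.\<close>

definition has_fourier_transform ::
    "(real ^ 'n \<Rightarrow> complex) \<Rightarrow> (real ^ 'n \<Rightarrow> complex) \<Rightarrow> bool" where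
  "has_fourier_transform F G \<longleftrightarrow>
     (\<forall>g. schwartz_function g \<longrightarrow>
        integrable lborel (\<lambda>x. F x * fourier_integral g x) \<and>
        integrable lborel (\<lambda>\<omega>. G \<omega> * g \<omega>) \<and>
        (LINT x|lborel. F x * fourier_integral g x) = (LINT \<omega>|lborel. G \<omega> * g \<omega>))"

definition compactly_supported :: "('a::topological_space \<Rightarrow> real) \<Rightarrow> bool" where
  "compactly_supported f \<longleftrightarrow> compact (closure (support_on UNIV f))"

end

theory Submission
  imports Defs "HOL-Probability.Characteristic_Functions" "HOL-Probability.Sinc_Integral"
begin

text \<open>By the reproducing property, a linear combination of values of \<open>f\<close> in the native space
  satisfies \<open>(\<Sum>j. a j * f (x j))\<^sup>2 \<le> ip f f * (\<Sum>j. \<Sum>k. a j * a k * \<Phi> (x j - x k))\<close>, and on the Fourier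
  side the double sum is at most a constant times the integral of
  \<open>exp (- c * norm \<omega>) * (cmod (\<Sum>j. a j * cis (x j \<bullet> \<omega>)))\<^sup>2\<close>. Take equispaced \<open>x j\<close> of step \<open>s / N\<close> on a
  line and let \<open>a\<close> be the coefficients of the Newton extrapolation error from the nodes
  \<open>0, \<dots>, N\<close> to the node \<open>2 * N\<close>. If \<open>f\<close> vanishes on the half line containing the first
  nodes, the left-hand side is the square of the value of \<open>f\<close> at distance \<open>s\<close> beyond it, while for
  \<open>s \<le> c / 16\<close> the right-hand side is \<open>O((1/4) ^ N)\<close>. So \<open>f\<close> vanishes on a half line longer by
  \<open>c / 16\<close>, hence on every line that leaves its support, without any appeal to analyticity.\<close>

subsection \<open>Gaussian and exponential integrals\<close>

lemma integral_lborel_affine: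
  fixes f :: "'a::euclidean_space \<Rightarrow> 'b::{banach, second_countable_topology}"
  assumes [measurable]: "f \<in> borel_measurable borel" and c: "c \<noteq> 0"
  shows "(LINT x|lborel. f x) = \<bar>c\<bar> ^ DIM('a) *\<^sub>R (LINT x|lborel. f (t + c *\<^sub>R x))"
proof -
  have "(LINT x|lborel. f x)
      = (LINT x|density (distr lborel borel (\<lambda>x. t + c *\<^sub>R x)) (\<lambda>_. ennreal (\<bar>c\<bar> ^ DIM('a))). f x)"
    by (subst lborel_affine[OF c, of t]) (rule refl)
  also have "\<dots> = (LINT x|distr lborel borel (\<lambda>x. t + c *\<^sub>R x). \<bar>c\<bar> ^ DIM('a) *\<^sub>R f x)"
    by (subst integral_density) auto
  also have "\<dots> = (LINT x|lborel. \<bar>c\<bar> ^ DIM('a) *\<^sub>R f (t + c *\<^sub>R x))"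
    by (subst integral_distr) auto
  finally show ?thesis by simp
qed

lemma
  fixes f :: "'a::euclidean_space \<Rightarrow> real \<Rightarrow> 'b::{real_normed_field, banach, second_countable_topology}"
  assumes f: "\<And>b. b \<in> Basis \<Longrightarrow> integrable lborel (f b)"
  shows integrable_lborel_prod: "integrable lborel (\<lambda>x::'a. \<Prod>b\<in>Basis. f b (x \<bullet> b))"
    and integral_lborel_prod:
      "(LINT x|lborel. (\<Prod>b\<in>Basis. f b ((x::'a) \<bullet> b))) = (\<Prod>b\<in>Basis. LINT t|lborel. f b t)"
proof -
  interpret product_sigma_finite "\<lambda>_::'a. lborel :: real measure" ..
  have [measurable]: "f b \<in> borel_measurable borel" if "b \<in> Basis" for b
    using borel_measurable_integrable[OF f[OF that]] by simp
  have S: "(\<Sum>b\<in>Basis. \<phi> b *\<^sub>R b) \<bullet> b' = \<phi> b'" if "b' \<in> Basis" for \<phi> and b' :: 'a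
    using that by simp
  have P: "(\<lambda>\<phi>. \<Prod>b\<in>Basis. f b ((\<Sum>b\<in>Basis. \<phi> b *\<^sub>R b) \<bullet> b)) = (\<lambda>\<phi>. \<Prod>b\<in>Basis. f b (\<phi> b))"
    by (intro ext prod.cong refl) (simp add: S)
  show "integrable lborel (\<lambda>x::'a. \<Prod>b\<in>Basis. f b (x \<bullet> b))"
    by (subst lborel_eq, subst integrable_distr_eq)
      (auto simp: P intro!: product_integrable_prod f)
  show "(LINT x|lborel. (\<Prod>b\<in>Basis. f b ((x::'a) \<bullet> b))) = (\<Prod>b\<in>Basis. LINT t|lborel. f b t)"
    by (subst lborel_eq, subst integral_distr)
      (auto simp: P intro!: product_integral_prod f)
qed

text \<open>Up to the factor \<open>sqrt (2 * pi)\<close> the integrand is the standard normal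
  density times \<open>iexp (s * t)\<close>, so the value is read off from the characteristic
  function of the normal distribution.\<close>

lemma
  fixes s :: real
  shows integrable_exp_gaussian_real: "integrable lborel (\<lambda>t. exp (\<i> * of_real (s * t) - of_real (t\<^sup>2 / 2)))"
    and integral_exp_gaussian_real:
      "(LINT t|lborel. exp (\<i> * of_real (s * t) - of_real (t\<^sup>2 / 2)))
        = of_real (sqrt (2 * pi) * exp (- s\<^sup>2 / 2))"
proof -
  have E: "exp (\<i> * of_real (s * t) - of_real (t\<^sup>2 / 2))
      = of_real (sqrt (2 * pi)) * (std_normal_density t *\<^sub>R iexp (s * t))" for t :: real
  proof -
    have "sqrt (2 * pi) * std_normal_density t = exp (- (t\<^sup>2 / 2))"
      by (simp add: std_normal_density_def)
    then have "of_real (sqrt (2 * pi)) * of_real (std_normal_density t) = exp (- of_real (t\<^sup>2 / 2) :: complex)"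
      by (simp only: exp_of_real flip: of_real_mult of_real_minus)
    then show ?thesis
      by (simp only: scaleR_conv_of_real diff_conv_add_uminus exp_add mult.assoc[symmetric])
        (simp add: mult.commute)
  qed
  interpret N: prob_space std_normal_distribution
    by (rule prob_space_normal_density) simp
  have "integrable std_normal_distribution (\<lambda>t. iexp (s * t))"
    by (rule N.integrable_const_bound[where B=1]) auto
  then have I: "integrable lborel (\<lambda>t. std_normal_density t *\<^sub>R iexp (s * t))"
    by (subst (asm) integrable_density) auto
  show "integrable lborel (\<lambda>t. exp (\<i> * of_real (s * t) - of_real (t\<^sup>2 / 2)))"
    unfolding E using I by (intro integrable_mult_right)
  have "(LINT t|lborel. std_normal_density t *\<^sub>R iexp (s * t)) = char std_normal_distribution s"
    unfolding char_def by (subst integral_density) auto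
  then show "(LINT t|lborel. exp (\<i> * of_real (s * t) - of_real (t\<^sup>2 / 2)))
        = of_real (sqrt (2 * pi) * exp (- s\<^sup>2 / 2))"
    unfolding E integral_mult_right_zero by (simp add: char_std_normal_distribution)
qed

text \<open>Both the phase and the Gaussian are exponentials of sums over coordinates, so the
  integrand factors and Fubini reduces everything to dimension one.\<close>

lemma
  fixes y :: "'a::euclidean_space"
  shows integrable_exp_gaussian:
      "integrable lborel (\<lambda>x. exp (\<i> * of_real (y \<bullet> x) - of_real ((norm x)\<^sup>2 / 2)))"
    and integral_exp_gaussian:
      "(LINT x|lborel. exp (\<i> * of_real (y \<bullet> x) - of_real ((norm x)\<^sup>2 / 2)))
        = of_real ((2 * pi) powr (DIM('a) / 2) * exp (- (norm y)\<^sup>2 / 2))"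
proof -
  have n: "(norm x)\<^sup>2 = (\<Sum>b\<in>Basis. (x \<bullet> b)\<^sup>2)" for x :: 'a
    unfolding power2_norm_eq_inner by (subst euclidean_inner) (simp add: power2_eq_square)
  have E: "exp (\<i> * of_real (y \<bullet> x) - of_real ((norm x)\<^sup>2 / 2))
      = (\<Prod>b\<in>Basis. exp (\<i> * of_real ((y \<bullet> b) * (x \<bullet> b)) - of_real ((x \<bullet> b)\<^sup>2 / 2)))" for x :: 'a
    by (subst euclidean_inner)
      (simp add: n sum_divide_distrib sum_distrib_left flip: exp_sum sum_subtractf)
  show "integrable lborel (\<lambda>x. exp (\<i> * of_real (y \<bullet> x) - of_real ((norm x)\<^sup>2 / 2)))"
    unfolding E by (intro integrable_lborel_prod integrable_exp_gaussian_real)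
  have "(2 * pi) powr (DIM('a) / 2) = sqrt (2 * pi) ^ DIM('a)"
    by (simp add: powr_half_sqrt[symmetric] powr_powr flip: powr_realpow)
  moreover have "(\<Prod>b\<in>Basis. exp (- (y \<bullet> b)\<^sup>2 / 2)) = exp (- (norm y)\<^sup>2 / 2)"
    by (simp add: n sum_divide_distrib sum_negf flip: exp_sum)
  ultimately have "(\<Prod>b\<in>Basis. of_real (sqrt (2 * pi) * exp (- (y \<bullet> b)\<^sup>2 / 2)) :: complex)
      = of_real ((2 * pi) powr (DIM('a) / 2) * exp (- (norm y)\<^sup>2 / 2))"
    by (simp only: prod.distrib prod_constant flip: of_real_prod)
  then show "(LINT x|lborel. exp (\<i> * of_real (y \<bullet> x) - of_real ((norm x)\<^sup>2 / 2)))
        = of_real ((2 * pi) powr (DIM('a) / 2) * exp (- (norm y)\<^sup>2 / 2))"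
    unfolding E
    by (subst integral_lborel_prod)
      (simp_all only: integrable_exp_gaussian_real integral_exp_gaussian_real)
qed

lemma integrable_exp_neg_abs:
  fixes a :: real
  assumes "a > 0"
  shows "integrable lborel (\<lambda>t. exp (- a * \<bar>t\<bar>))"
proof (rule Bochner_Integration.integrable_bound)
  \<comment> \<open>The entry 1 dominates the constant term of \<open>1 + t\<^sup>2\<close>, and the
    entry \<open>2 / a\<^sup>2\<close> turns the quadratic Taylor term of
    \<open>exp (a * \<bar>t\<bar>)\<close> into at least \<open>t\<^sup>2\<close>.\<close>
  let ?B = "max 1 (2 / a\<^sup>2)"
  show "integrable lborel (\<lambda>t. ?B * inverse (1 + t\<^sup>2))"
    using integrable_inverse_1_plus_square by (simp add: set_integrable_def)
  have "exp (- a * \<bar>t\<bar>) \<le> ?B * inverse (1 + t\<^sup>2)" for t :: real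
  proof -
    have "1 + t\<^sup>2 \<le> ?B * (1 + (a * \<bar>t\<bar>)\<^sup>2 / 2)"
    proof -
      have "t\<^sup>2 = 2 / a\<^sup>2 * ((a * \<bar>t\<bar>)\<^sup>2 / 2)"
        using assms by (simp add: power_mult_distrib)
      also have "\<dots> \<le> ?B * ((a * \<bar>t\<bar>)\<^sup>2 / 2)"
        by (intro mult_right_mono) auto
      finally show ?thesis
        unfolding distrib_left by (intro add_mono) auto
    qed
    also have "\<dots> \<le> ?B * exp (a * \<bar>t\<bar>)"
    proof (rule mult_left_mono)
      show "1 + (a * \<bar>t\<bar>)\<^sup>2 / 2 \<le> exp (a * \<bar>t\<bar>)"
        using exp_lower_Taylor_quadratic[of "a * \<bar>t\<bar>"] assms
        by (smt (verit) mult_nonneg_nonneg abs_ge_zero)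
    qed auto
    finally have "exp (- a * \<bar>t\<bar>) * (1 + t\<^sup>2) \<le> exp (- a * \<bar>t\<bar>) * (?B * exp (a * \<bar>t\<bar>))"
      by (intro mult_left_mono) auto
    also have "\<dots> = ?B"
      by (simp add: mult.left_commute mult_exp_exp)
    finally have "exp (- a * \<bar>t\<bar>) * (1 + t\<^sup>2) \<le> ?B" .
    moreover have "1 + t\<^sup>2 > 0"
      by (simp add: add_pos_nonneg)
    ultimately show ?thesis
      by (simp add: field_simps)
  qed
  then show "AE t in lborel. norm (exp (- a * \<bar>t\<bar>)) \<le> norm (?B * inverse (1 + t\<^sup>2))"
    by (intro AE_I2) (metis abs_exp_cancel abs_ge_self order_trans real_norm_def)
qed simp

lemma integrable_exp_neg_norm:
  fixes a :: real
  assumes "a > 0"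
  shows "integrable lborel (\<lambda>x::'a::euclidean_space. exp (- a * norm x))"
proof (rule Bochner_Integration.integrable_bound)
  \<comment> \<open>The norm is at least the average of the absolute coordinates. With the rate
    divided by the dimension, a product of one-dimensional exponentials is therefore a
    majorant.\<close>
  let ?a = "a / DIM('a)"
  have "?a > 0" using assms by simp
  then show "integrable lborel (\<lambda>x::'a. \<Prod>b\<in>Basis. exp (- ?a * \<bar>x \<bullet> b\<bar>))"
    by (intro integrable_lborel_prod integrable_exp_neg_abs)
  have "exp (- a * norm x) \<le> (\<Prod>b\<in>Basis. exp (- ?a * \<bar>x \<bullet> b\<bar>))" for x :: 'a
  proof -
    have "(\<Sum>b\<in>Basis. \<bar>x \<bullet> b\<bar>) \<le> (\<Sum>b\<in>(Basis::'a set). norm x)"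
      by (intro sum_mono Basis_le_norm)
    also have "\<dots> = real DIM('a) * norm x" by simp
    finally have "?a * (\<Sum>b\<in>Basis. \<bar>x \<bullet> b\<bar>) \<le> ?a * (real DIM('a) * norm x)"
      using \<open>?a > 0\<close> by (intro mult_left_mono) auto
    then have "?a * (\<Sum>b\<in>Basis. \<bar>x \<bullet> b\<bar>) \<le> a * norm x"
      by simp
    then show ?thesis
      by (simp add: sum_distrib_left sum_negf flip: exp_sum)
  qed
  then show "AE x::'a in lborel. norm (exp (- a * norm x)) \<le> norm (\<Prod>b\<in>Basis. exp (- ?a * \<bar>x \<bullet> b\<bar>))"
    by (intro AE_I2) (simp add: abs_prod)
qed simp

subsection \<open>Modulated Gaussians as test functions\<close>

lemma sum_power_div_fact_le_exp:
  fixes u :: real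
  assumes "finite A" "u \<ge> 0"
  shows "(\<Sum>k\<in>A. u ^ k / fact k) \<le> exp u"
  using assms sum_le_suminf[OF summable_exp[of u], of A]
  by (simp add: exp_def divide_inverse mult.commute)

text \<open>A character damped by a Gaussian. The pure character with frequency \<open>x0\<close> is
  bounded but not a Schwartz function; it is the pointwise limit as \<delta> tends to 0.\<close>

definition wave_packet :: "real \<Rightarrow> 'a::euclidean_space \<Rightarrow> 'a \<Rightarrow> complex" where
  "wave_packet \<delta> x0 \<omega> = exp (\<i> * of_real (x0 \<bullet> \<omega>) - of_real (\<delta>\<^sup>2 * (norm \<omega>)\<^sup>2 / 2))"

lemma wave_packet_measurable [measurable]: "wave_packet \<delta> x0 \<in> borel_measurable borel"
  unfolding wave_packet_def by (intro borel_measurable_continuous_onI continuous_intros) auto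

lemma norm_wave_packet: "cmod (wave_packet \<delta> x0 \<omega>) = exp (- (\<delta>\<^sup>2 * (norm \<omega>)\<^sup>2 / 2))"
  by (simp add: wave_packet_def norm_exp)

text \<open>These are the polynomial multiples of one wave packet. The class is closed under partial
  derivatives and its members decay rapidly, which makes it the invariant for an induction over
  iterated partial derivatives.\<close>

inductive_set wave_packet_module :: "real \<Rightarrow> real ^ 'n \<Rightarrow> (real ^ 'n \<Rightarrow> complex) set"
  for \<delta> x0 where
  wave_packet: "wave_packet \<delta> x0 \<in> wave_packet_module \<delta> x0"
| add: "\<lbrakk>f \<in> wave_packet_module \<delta> x0; g \<in> wave_packet_module \<delta> x0\<rbrakk>
    \<Longrightarrow> (\<lambda>x. f x + g x) \<in> wave_packet_module \<delta> x0"
| cmult: "f \<in> wave_packet_module \<delta> x0 \<Longrightarrow> (\<lambda>x. a * f x) \<in> wave_packet_module \<delta> x0"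
| coord: "f \<in> wave_packet_module \<delta> x0 \<Longrightarrow> (\<lambda>x. of_real (x $ i) * f x) \<in> wave_packet_module \<delta> x0"

lemma has_derivative_wave_packet:
  "(wave_packet \<delta> x0 has_derivative
    (\<lambda>v. wave_packet \<delta> x0 x * (\<i> * of_real (x0 \<bullet> v) - of_real (\<delta>\<^sup>2 * (x \<bullet> v))))) (at x)"
proof -
  have "((\<lambda>x. \<i> * of_real (x0 \<bullet> x) - of_real (\<delta>\<^sup>2 * (x \<bullet> x) / 2)) has_derivative
      (\<lambda>v. \<i> * of_real (x0 \<bullet> v) - of_real (\<delta>\<^sup>2 * (x \<bullet> v)))) (at x)"
  proof -
    have r: "((\<lambda>x. \<delta>\<^sup>2 * (x \<bullet> x) / 2) has_derivative (\<lambda>v. \<delta>\<^sup>2 * (x \<bullet> v + v \<bullet> x) / 2)) (at x)"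
      using has_derivative_mult_right[OF has_derivative_inner[OF has_derivative_ident has_derivative_ident],
          of "\<delta>\<^sup>2 / 2" x UNIV]
      by simp
    have "((\<lambda>x. \<i> * of_real (x0 \<bullet> x) - of_real (\<delta>\<^sup>2 * (x \<bullet> x) / 2)) has_derivative
        (\<lambda>v. \<i> * of_real (x0 \<bullet> v) - of_real (\<delta>\<^sup>2 * (x \<bullet> v + v \<bullet> x) / 2))) (at x)"
      by (intro has_derivative_diff has_derivative_mult_right has_derivative_of_real
          has_derivative_inner_right has_derivative_ident r)
    then show ?thesis
      by (simp add: inner_commute[of _ x])
  qed
  from has_derivative_compose[OF this, of exp "(*) (exp (\<i> * of_real (x0 \<bullet> x) - of_real (\<delta>\<^sup>2 * (x \<bullet> x) / 2)))"]
  have "((\<lambda>x. exp (\<i> * of_real (x0 \<bullet> x) - of_real (\<delta>\<^sup>2 * (x \<bullet> x) / 2))) has_derivative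
      (\<lambda>v. exp (\<i> * of_real (x0 \<bullet> x) - of_real (\<delta>\<^sup>2 * (x \<bullet> x) / 2)) *
        (\<i> * of_real (x0 \<bullet> v) - of_real (\<delta>\<^sup>2 * (x \<bullet> v))))) (at x)"
    using DERIV_exp[unfolded has_field_derivative_def] by blast
  then show ?thesis
    by (simp add: wave_packet_def[abs_def] power2_norm_eq_inner)
qed

text \<open>Differentiating the exponential brings down a factor affine in \<open>x\<close>, which
  the module absorbs. The total derivative \<open>D\<close> is kept as a witness so that it can
  later be identified with \<open>frechet_derivative\<close>.\<close>

lemma wave_packet_module_has_derivative:
  fixes x0 :: "real ^ 'n"
  assumes "f \<in> wave_packet_module \<delta> x0"
  shows "\<exists>D. (\<forall>x. (f has_derivative D x) (at x)) \<and>
    (\<forall>i. (\<lambda>x. D x (axis i 1)) \<in> wave_packet_module \<delta> x0)"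
  using assms
proof induction
  case wave_packet
  show ?case
  proof (intro exI conjI allI)
    show "(wave_packet \<delta> x0 has_derivative
        (\<lambda>v. wave_packet \<delta> x0 x * (\<i> * of_real (x0 \<bullet> v) - of_real (\<delta>\<^sup>2 * (x \<bullet> v))))) (at x)" for x
      by (rule has_derivative_wave_packet)
    fix i
    have "(\<lambda>x. (\<i> * of_real (x0 $ i)) * wave_packet \<delta> x0 x
          + (- of_real (\<delta>\<^sup>2)) * (of_real (x $ i) * wave_packet \<delta> x0 x)) \<in> wave_packet_module \<delta> x0"
      by (intro wave_packet_module.intros)
    then show "(\<lambda>x. wave_packet \<delta> x0 x * (\<i> * of_real (x0 \<bullet> axis i 1)
        - of_real (\<delta>\<^sup>2 * (x \<bullet> axis i 1)))) \<in> wave_packet_module \<delta> x0"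
      by (simp add: inner_axis algebra_simps)
  qed
next
  case (add f g)
  then obtain D E where D: "\<And>x. (f has_derivative D x) (at x)" "\<And>x. (g has_derivative E x) (at x)"
    "\<And>i. (\<lambda>x. D x (axis i 1)) \<in> wave_packet_module \<delta> x0"
    "\<And>i. (\<lambda>x. E x (axis i 1)) \<in> wave_packet_module \<delta> x0"
    by blast
  show ?case
    by (rule exI[of _ "\<lambda>x v. D x v + E x v"])
      (auto intro!: has_derivative_add D wave_packet_module.intros)
next
  case (cmult f a)
  then obtain D where D: "\<And>x. (f has_derivative D x) (at x)"
    "\<And>i. (\<lambda>x. D x (axis i 1)) \<in> wave_packet_module \<delta> x0"
    by blast
  show ?case
    by (rule exI[of _ "\<lambda>x v. a * D x v"])
      (auto intro!: has_derivative_mult_right D wave_packet_module.intros)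
next
  case (coord f i)
  then obtain D where D: "\<And>x. (f has_derivative D x) (at x)"
    "\<And>i. (\<lambda>x. D x (axis i 1)) \<in> wave_packet_module \<delta> x0"
    by blast
  show ?case
  proof (intro exI conjI allI)
    have "((\<lambda>x. of_real (x $ i) :: complex) has_derivative (\<lambda>v. of_real (v $ i))) (at x)" for x :: "real ^ 'n"
      by (intro bounded_linear.has_derivative[OF bounded_linear_of_real]
          bounded_linear_imp_has_derivative bounded_linear_vec_nth)
    from has_derivative_mult[OF this D(1)]
    show "((\<lambda>x. of_real (x $ i) * f x) has_derivative
        (\<lambda>v. of_real (x $ i) * D x v + of_real (v $ i) * f x)) (at x)" for x .
    show "(\<lambda>x. of_real (x $ i) * D x (axis j 1) + of_real (axis j 1 $ i) * f x)
        \<in> wave_packet_module \<delta> x0" for j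
      by (intro wave_packet_module.intros D coord)
  qed
qed

text \<open>Passing from \<open>r ^ k\<close> to the even power \<open>r ^ (2 * k)\<close> makes it
  a multiple of the \<open>k\<close>-th power of the Gaussian exponent, and a single term of the
  exponential series bounds that.\<close>

lemma power_times_gaussian_le:
  fixes r \<delta> :: real
  assumes "\<delta> \<noteq> 0" "r \<ge> 0"
  shows "r ^ k * exp (- (\<delta>\<^sup>2 * r\<^sup>2 / 2)) \<le> 1 + (2 / \<delta>\<^sup>2) ^ k * fact k"
proof -
  let ?u = "\<delta>\<^sup>2 * r\<^sup>2 / 2"
  have "r ^ k \<le> 1 + r ^ (2 * k)"
  proof (cases "r \<le> 1")
    case True
    then show ?thesis using assms power_le_one[of r k] zero_le_power[of r "2 * k"] by linarith
  next
    case False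
    then have "r ^ k \<le> r ^ (2 * k)" by (intro power_increasing) auto
    then show ?thesis by simp
  qed
  also have "r ^ (2 * k) = (2 / \<delta>\<^sup>2 * ?u) ^ k"
    using assms by (simp add: power_mult)
  also have "\<dots> \<le> (2 / \<delta>\<^sup>2) ^ k * (fact k * exp ?u)"
    unfolding power_mult_distrib using sum_power_div_fact_le_exp[of "{k}" ?u]
    by (intro mult_left_mono) (auto simp: field_simps)
  finally have "r ^ k * exp (- ?u) \<le> (1 + (2 / \<delta>\<^sup>2) ^ k * (fact k * exp ?u)) * exp (- ?u)"
    by (intro mult_right_mono) auto
  also have "\<dots> = exp (- ?u) + (2 / \<delta>\<^sup>2) ^ k * fact k"
    by (simp add: algebra_simps mult_exp_exp)
  also have "exp (- ?u) \<le> 1"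
    by simp
  finally show ?thesis by simp
qed

lemma wave_packet_module_decay:
  assumes "f \<in> wave_packet_module \<delta> x0" "\<delta> \<noteq> 0"
  shows "\<exists>B. \<forall>x. norm x ^ k * cmod (f x) \<le> B"
  using assms(1)
\<comment> \<open>Multiplication by a coordinate costs one power of the norm, so the induction
  hypothesis is used there at \<open>Suc k\<close>.\<close>
proof (induction arbitrary: k)
  case wave_packet
  show ?case
    unfolding norm_wave_packet using power_times_gaussian_le[OF assms(2) norm_ge_zero] by blast
next
  case (add f g)
  obtain A B where AB: "\<And>x. norm x ^ k * cmod (f x) \<le> A" "\<And>x. norm x ^ k * cmod (g x) \<le> B"
    using add.IH by meson
  have "norm x ^ k * cmod (f x + g x) \<le> A + B" for x
  proof -
    have "norm x ^ k * cmod (f x + g x) \<le> norm x ^ k * (cmod (f x) + cmod (g x))"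
      by (intro mult_left_mono norm_triangle_ineq) auto
    with AB[of x] show ?thesis by (simp add: distrib_left)
  qed
  then show ?case by blast
next
  case (cmult f a)
  obtain A where A: "\<And>x. norm x ^ k * cmod (f x) \<le> A"
    using cmult.IH by meson
  have "norm x ^ k * cmod (a * f x) \<le> cmod a * A" for x
    using mult_left_mono[OF A[of x], of "cmod a"] by (simp add: norm_mult mult.left_commute)
  then show ?case by blast
next
  case (coord f i)
  obtain A where A: "\<And>x. norm x ^ Suc k * cmod (f x) \<le> A"
    using coord.IH by meson
  have "norm x ^ k * cmod (of_real (x $ i) * f x) \<le> A" for x
  proof -
    have "norm x ^ k * cmod (of_real (x $ i) * f x) \<le> norm x ^ k * (norm x * cmod (f x))"
      unfolding norm_mult norm_of_real
      by (intro mult_left_mono mult_right_mono component_le_norm_cart) auto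
    also have "\<dots> \<le> A" using A[of x] by (simp add: mult_ac)
    finally show ?thesis .
  qed
  then show ?case by blast
qed

lemma schwartz_wave_packet:
  assumes "\<delta> \<noteq> 0"
  shows "schwartz_function (wave_packet \<delta> x0)"
proof -
  have S: "iterated_partial is (wave_packet \<delta> x0) \<in> wave_packet_module \<delta> x0" for "is"
  proof (induction "is")
    case Nil
    show ?case by (simp add: wave_packet_module.wave_packet)
  next
    case (Cons i js)
    obtain D where D: "\<And>x. (iterated_partial js (wave_packet \<delta> x0) has_derivative D x) (at x)"
      "\<And>i. (\<lambda>x. D x (axis i 1)) \<in> wave_packet_module \<delta> x0"
      using wave_packet_module_has_derivative[OF Cons.IH] by blast
    show ?case
      using D(2)[of i] by (simp flip: frechet_derivative_at[OF D(1)])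
  qed
  show ?thesis
    unfolding schwartz_function_def
  proof (intro conjI allI)
    fix js :: "'a list" and k
    show "iterated_partial js (wave_packet \<delta> x0) differentiable_on UNIV"
      using wave_packet_module_has_derivative[OF S[of js]]
      by (meson differentiable_def differentiable_at_imp_differentiable_on)
    show "bounded (range (\<lambda>x. norm x ^ k *\<^sub>R iterated_partial js (wave_packet \<delta> x0) x))"
      using wave_packet_module_decay[OF S[of js] assms, of k]
      by (auto simp: bounded_iff)
  qed
qed

text \<open>Scaling by \<open>1 / \<delta>\<close> reduces this to the standard Gaussian. The result
  is a bump of width \<delta> around \<open>x0\<close> whose total mass
  \<open>(2 * pi) powr (CARD('n) / 2)\<close> is the same for all \<delta>: an approximate identity
  up to that constant.\<close>

lemma fourier_integral_wave_packet:
  fixes x0 y :: "real ^ 'n"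
  assumes "\<delta> > 0"
  shows "fourier_integral (wave_packet \<delta> x0) y
    = of_real ((1 / \<delta>) ^ CARD('n) * exp (- (norm ((1 / \<delta>) *\<^sub>R (x0 - y)))\<^sup>2 / 2))"
proof -
  let ?z = "(1 / \<delta>) *\<^sub>R (x0 - y)"
  have E: "wave_packet \<delta> x0 ((1 / \<delta>) *\<^sub>R u) * exp (- \<i> * of_real (((1 / \<delta>) *\<^sub>R u) \<bullet> y))
      = exp (\<i> * of_real (?z \<bullet> u) - of_real ((norm u)\<^sup>2 / 2))" for u
    using assms unfolding wave_packet_def mult_exp_exp
    by (simp add: inner_diff_left inner_commute[of u] power_divide algebra_simps diff_divide_distrib)
  have "(LINT x|lborel. wave_packet \<delta> x0 x * exp (- \<i> * of_real (x \<bullet> y)))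
      = \<bar>1 / \<delta>\<bar> ^ DIM(real ^ 'n) *\<^sub>R
        (LINT u|lborel. wave_packet \<delta> x0 (0 + (1 / \<delta>) *\<^sub>R u)
          * exp (- \<i> * of_real ((0 + (1 / \<delta>) *\<^sub>R u) \<bullet> y)))"
    using assms by (intro integral_lborel_affine) auto
  also have "\<dots> = (1 / \<delta>) ^ CARD('n) *\<^sub>R
      of_real ((2 * pi) powr (CARD('n) / 2) * exp (- (norm ?z)\<^sup>2 / 2))"
    using assms by (simp only: E add_0_left integral_exp_gaussian) simp
  finally have "fourier_integral (wave_packet \<delta> x0) y
      = of_real ((2 * pi) powr (- (CARD('n) / 2)) *
         ((1 / \<delta>) ^ CARD('n) * ((2 * pi) powr (CARD('n) / 2) * exp (- (norm ?z)\<^sup>2 / 2))))"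
    unfolding fourier_integral_def
    by (simp only: scaleR_conv_of_real of_real_mult minus_divide_left)
  also have "(2 * pi) powr (- (CARD('n) / 2)) *
         ((1 / \<delta>) ^ CARD('n) * ((2 * pi) powr (CARD('n) / 2) * exp (- (norm ?z)\<^sup>2 / 2)))
      = (1 / \<delta>) ^ CARD('n) * exp (- (norm ?z)\<^sup>2 / 2)"
    by (simp add: powr_minus)
  finally show ?thesis .
qed

subsection \<open>The quadratic form on the Fourier side\<close>

text \<open>The substitution \<open>x = z + \<delta> *\<^sub>R u\<close> cancels the powers of
  \<delta> and leaves a fixed Gaussian weight, with \<delta> only inside the argument of
  \<open>F\<close>. In this form dominated convergence applies.\<close>

lemma has_fourier_transform_wave_packet:
  fixes F G :: "real ^ 'n \<Rightarrow> complex"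
  assumes FG: "has_fourier_transform F G" and F [measurable]: "F \<in> borel_measurable borel" and \<delta>: "\<delta> > 0"
  shows "integrable lborel (\<lambda>\<omega>. G \<omega> * wave_packet \<delta> z \<omega>)"
    and "(LINT \<omega>|lborel. G \<omega> * wave_packet \<delta> z \<omega>)
      = (LINT u|lborel. F (z + \<delta> *\<^sub>R u) * of_real (exp (- (norm u)\<^sup>2 / 2)))"
proof -
  have S: "schwartz_function (wave_packet \<delta> z)"
    using \<delta> by (intro schwartz_wave_packet) auto
  show "integrable lborel (\<lambda>\<omega>. G \<omega> * wave_packet \<delta> z \<omega>)"
    using FG S unfolding has_fourier_transform_def by blast
  have "(LINT \<omega>|lborel. G \<omega> * wave_packet \<delta> z \<omega>)
      = (LINT x|lborel. F x * fourier_integral (wave_packet \<delta> z) x)"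
    using FG S unfolding has_fourier_transform_def by metis
  also have "\<dots> = (LINT x|lborel. F x *
      of_real ((1 / \<delta>) ^ CARD('n) * exp (- (norm ((1 / \<delta>) *\<^sub>R (z - x)))\<^sup>2 / 2)))"
    by (simp only: fourier_integral_wave_packet[OF \<delta>])
  also have "\<dots> = \<bar>\<delta>\<bar> ^ DIM(real ^ 'n) *\<^sub>R (LINT u|lborel. F (z + \<delta> *\<^sub>R u) *
      of_real ((1 / \<delta>) ^ CARD('n) * exp (- (norm ((1 / \<delta>) *\<^sub>R (z - (z + \<delta> *\<^sub>R u))))\<^sup>2 / 2)))"
    using \<delta> by (intro integral_lborel_affine) auto
  also have "\<dots> = (LINT u|lborel. \<delta> ^ CARD('n) *\<^sub>R (F (z + \<delta> *\<^sub>R u) *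
      of_real ((1 / \<delta>) ^ CARD('n) * exp (- (norm u)\<^sup>2 / 2))))"
    using \<delta> by simp
  also have "(\<lambda>u. \<delta> ^ CARD('n) *\<^sub>R (F (z + \<delta> *\<^sub>R u) *
      of_real ((1 / \<delta>) ^ CARD('n) * exp (- (norm u)\<^sup>2 / 2))))
      = (\<lambda>u. F (z + \<delta> *\<^sub>R u) * of_real (exp (- (norm u)\<^sup>2 / 2)))"
    using \<delta> by (simp add: scaleR_conv_of_real power_divide)
  finally show "(LINT \<omega>|lborel. G \<omega> * wave_packet \<delta> z \<omega>)
      = (LINT u|lborel. F (z + \<delta> *\<^sub>R u) * of_real (exp (- (norm u)\<^sup>2 / 2)))" .
qed

text \<open>The transform is known only through integrable products with test functions. A wave
  packet vanishes nowhere, so dividing such a product by it recovers \<open>G\<close>.\<close>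

lemma has_fourier_transform_measurable:
  fixes F G :: "real ^ 'n \<Rightarrow> complex"
  assumes FG: "has_fourier_transform F G" and F: "F \<in> borel_measurable borel"
  shows "G \<in> borel_measurable borel"
proof -
  have "(\<lambda>\<omega>. G \<omega> * wave_packet 1 0 \<omega>) \<in> borel_measurable borel"
    using borel_measurable_integrable[OF has_fourier_transform_wave_packet(1)[OF FG F, of 1 0]] by simp
  then have "(\<lambda>\<omega>. G \<omega> * wave_packet 1 0 \<omega> / wave_packet 1 0 \<omega>) \<in> borel_measurable borel"
    by (intro borel_measurable_divide) auto
  then show ?thesis
    by (simp add: wave_packet_def)
qed

lemma tendsto_gaussian_average:
  fixes F :: "'a::euclidean_space \<Rightarrow> complex"
  assumes F: "continuous_on UNIV F" and B: "\<And>x. cmod (F x) \<le> B" and \<delta>: "\<delta> \<longlonglongrightarrow> 0"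
  shows "(\<lambda>n. LINT u|lborel. F (z + \<delta> n *\<^sub>R u) * of_real (exp (- (norm u)\<^sup>2 / 2)))
    \<longlonglongrightarrow> of_real ((2 * pi) powr (DIM('a) / 2)) * F z"
proof -
  have [measurable]: "F \<in> borel_measurable borel"
    using F by (rule borel_measurable_continuous_onI)
  have g: "exp (\<i> * of_real ((0::'a) \<bullet> u) - of_real ((norm u)\<^sup>2 / 2)) = of_real (exp (- (norm u)\<^sup>2 / 2))" for u :: 'a
    by (simp add: exp_of_real[symmetric])
  have I: "integrable lborel (\<lambda>u::'a. complex_of_real (exp (- (norm u)\<^sup>2 / 2)))"
    using integrable_exp_gaussian[of "0::'a"] by (simp only: g)
  have "(\<lambda>n. LINT u|lborel. F (z + \<delta> n *\<^sub>R u) * of_real (exp (- (norm u)\<^sup>2 / 2)))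
      \<longlonglongrightarrow> (LINT u|lborel. F z * of_real (exp (- (norm (u::'a))\<^sup>2 / 2)))"
  proof (rule integral_dominated_convergence)
    show "integrable lborel (\<lambda>u::'a. B * exp (- (norm u)\<^sup>2 / 2))"
      using integrable_norm[OF I] by (intro integrable_mult_right) simp
    show "AE u in lborel. (\<lambda>n. F (z + \<delta> n *\<^sub>R u) * of_real (exp (- (norm u)\<^sup>2 / 2)))
        \<longlonglongrightarrow> F z * of_real (exp (- (norm u)\<^sup>2 / 2))"
    proof (intro AE_I2 tendsto_mult tendsto_const)
      fix u :: 'a
      have "(\<lambda>n. z + \<delta> n *\<^sub>R u) \<longlonglongrightarrow> z"
        using \<delta> by (auto intro!: tendsto_eq_intros)
      then show "(\<lambda>n. F (z + \<delta> n *\<^sub>R u)) \<longlonglongrightarrow> F z"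
        using F by (intro continuous_on_tendsto_compose[OF F]) auto
    qed
    show "AE u in lborel. norm (F (z + \<delta> n *\<^sub>R u) * of_real (exp (- (norm u)\<^sup>2 / 2)))
        \<le> B * exp (- (norm u)\<^sup>2 / 2)" for n
      by (intro AE_I2) (auto simp: norm_mult intro!: mult_right_mono B)
  qed measurable
  also have "(LINT u|lborel. F z * of_real (exp (- (norm (u::'a))\<^sup>2 / 2)))
      = F z * of_real ((2 * pi) powr (DIM('a) / 2))"
    using integral_exp_gaussian[of "0::'a"] unfolding g by simp
  finally show ?thesis by (simp add: mult.commute)
qed

text \<open>At a difference of points the phase splits into a character times a conjugate character,
  so the double sum is a trigonometric polynomial times its own conjugate.\<close>

lemma sum_sum_wave_packet:
  fixes a :: "'i \<Rightarrow> real" and x :: "'i \<Rightarrow> 'a::euclidean_space"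
  shows "(\<Sum>j\<in>J. \<Sum>k\<in>J. of_real (a j * a k) * wave_packet \<delta> (x j - x k) \<omega>)
    = of_real (exp (- (\<delta>\<^sup>2 * (norm \<omega>)\<^sup>2 / 2)) * (cmod (\<Sum>j\<in>J. of_real (a j) * cis (x j \<bullet> \<omega>)))\<^sup>2)"
proof -
  let ?P = "\<Sum>j\<in>J. of_real (a j) * cis (x j \<bullet> \<omega>)"
  have W: "wave_packet \<delta> (x j - x k) \<omega>
      = of_real (exp (- (\<delta>\<^sup>2 * (norm \<omega>)\<^sup>2 / 2))) * (cis (x j \<bullet> \<omega>) * cnj (cis (x k \<bullet> \<omega>)))" for j k
  proof -
    have "wave_packet \<delta> (x j - x k) \<omega>
        = exp (- of_real (\<delta>\<^sup>2 * (norm \<omega>)\<^sup>2 / 2)) * exp (\<i> * of_real (x j \<bullet> \<omega> - x k \<bullet> \<omega>))"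
      by (simp add: wave_packet_def inner_diff_left mult_exp_exp)
    also have "exp (\<i> * of_real (x j \<bullet> \<omega> - x k \<bullet> \<omega>)) = cis (x j \<bullet> \<omega>) * cnj (cis (x k \<bullet> \<omega>))"
      by (simp only: cis_conv_exp[symmetric] cis_cnj cis_mult) simp
    also have "exp (- of_real (\<delta>\<^sup>2 * (norm \<omega>)\<^sup>2 / 2) :: complex) = of_real (exp (- (\<delta>\<^sup>2 * (norm \<omega>)\<^sup>2 / 2)))"
      by (simp only: exp_of_real flip: of_real_minus)
    finally show ?thesis .
  qed
  have "of_real ((cmod ?P)\<^sup>2) = ?P * cnj ?P"
    by (rule complex_norm_square)
  also have "\<dots> = (\<Sum>j\<in>J. \<Sum>k\<in>J. of_real (a j * a k) * (cis (x j \<bullet> \<omega>) * cnj (cis (x k \<bullet> \<omega>))))"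
    by (simp add: sum_product mult_ac)
  finally show ?thesis
    unfolding W of_real_mult by (simp only: sum_distrib_left mult_ac)
qed

lemma integrable_exp_neg_norm_times_trig_poly:
  fixes a :: "'i \<Rightarrow> real" and x :: "'i \<Rightarrow> 'a::euclidean_space"
  assumes "c > 0"
  shows "integrable lborel (\<lambda>\<omega>. C * exp (- c * norm \<omega>) * (cmod (\<Sum>j\<in>J. of_real (a j) * cis (x j \<bullet> \<omega>)))\<^sup>2)"
proof (rule Bochner_Integration.integrable_bound)
  let ?A = "(\<Sum>j\<in>J. \<bar>a j\<bar>)\<^sup>2"
  show "integrable lborel (\<lambda>\<omega>::'a. C * exp (- c * norm \<omega>) * ?A)"
    using assms by (intro integrable_mult_left integrable_mult_right integrable_exp_neg_norm)
  have "cmod (\<Sum>j\<in>J. of_real (a j) * cis (x j \<bullet> \<omega>)) \<le> (\<Sum>j\<in>J. \<bar>a j\<bar>)" for \<omega>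
    by (rule order_trans[OF norm_sum]) (simp add: norm_mult)
  then have "(cmod (\<Sum>j\<in>J. of_real (a j) * cis (x j \<bullet> \<omega>)))\<^sup>2 \<le> ?A" for \<omega>
    by (intro power_mono) auto
  then show "AE \<omega> in lborel. norm (C * exp (- c * norm \<omega>) * (cmod (\<Sum>j\<in>J. of_real (a j) * cis (x j \<bullet> \<omega>)))\<^sup>2)
      \<le> norm (C * exp (- c * norm \<omega>) * ?A)"
    by (intro AE_I2) (simp add: abs_mult mult_left_mono)
  show "(\<lambda>\<omega>. C * exp (- c * norm \<omega>) * (cmod (\<Sum>j\<in>J. of_real (a j) * cis (x j \<bullet> \<omega>)))\<^sup>2) \<in> borel_measurable lborel"
    unfolding cis_conv_exp by measurable
qed

text \<open>Since the distributional Fourier transform is only tested against Schwartz functions, the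
  quadratic form is first computed with \<open>\<Phi>\<close> replaced by its averages against Gaussians of width
  \<open>\<delta>\<close>, and then \<open>\<delta>\<close> tends to \<open>0\<close>.\<close>

lemma quadratic_form_le_of_fourier_decay:
  fixes \<Phi> :: "real ^ 'n \<Rightarrow> real" and G :: "real ^ 'n \<Rightarrow> complex" and a :: "'i \<Rightarrow> real"
  assumes FG: "has_fourier_transform (\<lambda>x. complex_of_real (\<Phi> x)) G"
    and cont: "continuous_on UNIV \<Phi>" and B: "\<And>x. \<bar>\<Phi> x\<bar> \<le> B"
    and G: "\<And>\<omega>. cmod (G \<omega>) \<le> C * exp (- c * norm \<omega>)" and "c > 0"
  shows "(2 * pi) powr (CARD('n) / 2) * (\<Sum>j\<in>J. \<Sum>k\<in>J. a j * a k * \<Phi> (x j - x k))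
    \<le> (LINT \<omega>|lborel. C * exp (- c * norm \<omega>) * (cmod (\<Sum>j\<in>J. of_real (a j) * cis (x j \<bullet> \<omega>)))\<^sup>2)"
    (is "?m * ?Q \<le> ?R")
proof -
  let ?P = "\<lambda>\<omega>. \<Sum>j\<in>J. of_real (a j) * cis (x j \<bullet> \<omega>)"
  define F where "F = (\<lambda>x. complex_of_real (\<Phi> x))"
  have contF: "continuous_on UNIV F"
    unfolding F_def by (intro continuous_intros cont)
  then have F: "F \<in> borel_measurable borel"
    by (rule borel_measurable_continuous_onI)
  have [measurable]: "G \<in> borel_measurable borel"
    using has_fourier_transform_measurable FG F unfolding F_def by blast
  note W = has_fourier_transform_wave_packet[OF FG[folded F_def] F]
  define I where "I \<delta> z = (LINT u|lborel. F (z + \<delta> *\<^sub>R u) * of_real (exp (- (norm u)\<^sup>2 / 2)))" for \<delta> z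
  \<comment> \<open>The damping factor is at most 1, so this bound is uniform in \<delta> and
    survives the limit.\<close>
  have bound: "cmod (\<Sum>j\<in>J. \<Sum>k\<in>J. of_real (a j * a k) * I \<delta> (x j - x k)) \<le> ?R" if "\<delta> > 0" for \<delta>
  proof -
    have "(\<Sum>j\<in>J. \<Sum>k\<in>J. of_real (a j * a k) * I \<delta> (x j - x k))
        = (LINT \<omega>|lborel. (\<Sum>j\<in>J. \<Sum>k\<in>J. of_real (a j * a k) * (G \<omega> * wave_packet \<delta> (x j - x k) \<omega>)))"
      unfolding I_def W(2)[OF that, symmetric]
      by (simp add: W(1)[OF that] Bochner_Integration.integral_sum)
    also have "\<dots> = (LINT \<omega>|lborel. G \<omega> * of_real (exp (- (\<delta>\<^sup>2 * (norm \<omega>)\<^sup>2 / 2)) * (cmod (?P \<omega>))\<^sup>2))"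
      by (simp only: sum_sum_wave_packet[symmetric] sum_distrib_left mult.left_commute)
    also have "cmod \<dots> \<le> ?R"
    proof (rule Bochner_Integration.integral_norm_bound_integral)
      let ?g = "\<lambda>\<omega>. G \<omega> * of_real (exp (- (\<delta>\<^sup>2 * (norm \<omega>)\<^sup>2 / 2)) * (cmod (?P \<omega>))\<^sup>2)"
      show le: "cmod (?g \<omega>) \<le> C * exp (- c * norm \<omega>) * (cmod (?P \<omega>))\<^sup>2" for \<omega>
      proof -
        have "cmod (?g \<omega>) = cmod (G \<omega>) * (exp (- (\<delta>\<^sup>2 * (norm \<omega>)\<^sup>2 / 2)) * (cmod (?P \<omega>))\<^sup>2)"
          by (simp only: norm_mult norm_of_real abs_mult) simp
        also have "\<dots> \<le> (C * exp (- c * norm \<omega>)) * (1 * (cmod (?P \<omega>))\<^sup>2)"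
          using order_trans[OF norm_ge_zero G[of \<omega>]]
          by (intro mult_mono G mult_right_mono) auto
        finally show ?thesis by simp
      qed
      show int: "integrable lborel (\<lambda>\<omega>. C * exp (- c * norm \<omega>) * (cmod (?P \<omega>))\<^sup>2)"
        by (rule integrable_exp_neg_norm_times_trig_poly) fact
      have "?g \<in> borel_measurable lborel"
        unfolding cis_conv_exp by measurable
      then show "integrable lborel ?g"
        using le by (intro Bochner_Integration.integrable_bound[OF int] AE_I2)
          (auto intro: order_trans[OF _ abs_ge_self])
    qed
    finally show ?thesis .
  qed
  have "(\<lambda>n. I (1 / Suc n) z) \<longlonglongrightarrow> of_real ?m * F z" for z
    using tendsto_gaussian_average[OF contF, of B "\<lambda>n. 1 / Suc n" z] LIMSEQ_Suc[OF lim_1_over_n] B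
    by (simp add: I_def F_def)
  then have lim: "(\<lambda>n. \<Sum>j\<in>J. \<Sum>k\<in>J. of_real (a j * a k) * I (1 / Suc n) (x j - x k))
      \<longlonglongrightarrow> (\<Sum>j\<in>J. \<Sum>k\<in>J. of_real (a j * a k) * (of_real ?m * F (x j - x k)))"
    by (intro tendsto_sum tendsto_mult tendsto_const)
  have "cmod (\<Sum>j\<in>J. \<Sum>k\<in>J. of_real (a j * a k) * (of_real ?m * F (x j - x k))) \<le> ?R"
    by (rule LIMSEQ_le_const2[OF tendsto_norm[OF lim]]) (intro exI allI impI bound, simp)
  also have "(\<Sum>j\<in>J. \<Sum>k\<in>J. of_real (a j * a k) * (of_real ?m * F (x j - x k))) = of_real (?m * ?Q)"
    by (simp add: F_def sum_distrib_left mult_ac)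
  finally show ?thesis
    by (simp only: norm_of_real)
qed

subsection \<open>Extrapolation in the native space\<close>

text \<open>The axioms give positivity for nonzero functions; the zero function is covered by
  homogeneity with the scalar 0.\<close>

lemma hilbert_function_space_ip_nonneg:
  assumes H: "hilbert_function_space H ip" and f: "f \<in> H"
  shows "ip f f \<ge> 0"
proof (cases "f = (\<lambda>x. 0)")
  case True
  have "ip (\<lambda>x. 0 * f x) f = 0 * ip f f"
    using H f unfolding hilbert_function_space_def by blast
  then show ?thesis by (simp add: True)
next
  case False
  then have "ip f f > 0"
    using H f unfolding hilbert_function_space_def by blast
  then show ?thesis by simp
qed

lemma hilbert_function_space_Cauchy_Schwarz:
  assumes H: "hilbert_function_space H ip" and f: "f \<in> H" and g: "g \<in> H"
  shows "(ip f g)\<^sup>2 \<le> ip f f * ip g g"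
proof -
  have add: "(\<lambda>x. p x + q x) \<in> H" "ip (\<lambda>x. p x + q x) r = ip p r + ip q r"
    and scale: "(\<lambda>x. t * p x) \<in> H" "ip (\<lambda>x. t * p x) q = t * ip p q"
    and sym: "ip p q = ip q p"
    and pos: "p \<noteq> (\<lambda>x. 0) \<Longrightarrow> ip p p > 0"
    if "p \<in> H" "q \<in> H" "r \<in> H" for p q r t
    using H that unfolding hilbert_function_space_def by blast+
  have zero: "ip (\<lambda>x. 0) p = 0" if "p \<in> H" for p
    using scale(2)[OF that that that, of 0] by simp
  show ?thesis
  proof (cases "g = (\<lambda>x. 0)")
    case True
    then show ?thesis using zero[OF f] zero[OF g] sym[OF f g f] by simp
  next
    case False
    define A b D where "A = ip f f" and "b = ip f g" and "D = ip g g"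
    have D: "D > 0" using pos[OF g g g False] by (simp add: D_def)
    \<comment> \<open>This is \<open>D\<close> times the component of \<open>f\<close> orthogonal to
      \<open>g\<close>, scaled to avoid a division.\<close>
    let ?h = "\<lambda>x. D * f x + (- b) * g x"
    note fD = scale(1)[OF f f f, of D] and gb = scale(1)[OF g g g, of "- b"]
    note h = add(1)[OF fD gb fD]
    have "ip ?h p = D * ip f p + (- b) * ip g p" if "p \<in> H" for p
      by (simp only: add(2)[OF fD gb that] scale(2)[OF f that that] scale(2)[OF g that that])
    moreover have "ip f ?h = ip ?h f" "ip g ?h = ip ?h g"
      using sym[OF f h f] sym[OF g h f] by auto
    ultimately have "ip ?h ?h = D * (D * A - b * b) - b * (D * b - b * D)"
      using f g h sym[OF g f f] by (simp add: A_def b_def D_def)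
    then have "ip ?h ?h = D * (A * D - b\<^sup>2)"
      by (simp add: power2_eq_square algebra_simps)
    moreover have "ip ?h ?h \<ge> 0"
      by (rule hilbert_function_space_ip_nonneg[OF H h])
    ultimately have "A * D - b\<^sup>2 \<ge> 0"
      using D by (simp add: zero_le_mult_iff)
    then show ?thesis by (simp add: A_def b_def D_def)
  qed
qed

text \<open>The sum on the left is the inner product of \<open>f\<close> with the combination of
  kernel translates with coefficients \<open>a j\<close>; the double sum is the squared norm of that
  combination.\<close>

lemma native_space_sum_le:
  fixes a :: "'i \<Rightarrow> real"
  assumes N: "native_space K H ip" and f: "f \<in> H" and J: "finite J"
  shows "(\<Sum>j\<in>J. a j * f (x j))\<^sup>2 \<le> ip f f * (\<Sum>j\<in>J. \<Sum>k\<in>J. a j * a k * K (x j) (x k))"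
proof -
  have H: "hilbert_function_space H ip"
    and K: "(\<lambda>x. K x y) \<in> H"
    and rep: "p \<in> H \<Longrightarrow> ip p (\<lambda>x. K x y) = p y" for p y
    using N unfolding native_space_def by auto
  have zero: "(\<lambda>x. 0) \<in> H"
    and add: "(\<lambda>x. p x + q x) \<in> H" "ip (\<lambda>x. p x + q x) r = ip p r + ip q r"
    and scale: "(\<lambda>x. t * p x) \<in> H" "ip (\<lambda>x. t * p x) q = t * ip p q"
    and sym: "ip p q = ip q p"
    if "p \<in> H" "q \<in> H" "r \<in> H" for p q r t
    using H that unfolding hilbert_function_space_def by blast+
  let ?g = "\<lambda>J z. \<Sum>j\<in>J. a j * K z (x j)"
  \<comment> \<open>Membership and the evaluation formula are proved together, because additivity of
    \<open>ip\<close> holds only for arguments in \<open>H\<close>.\<close>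
  have g: "?g J \<in> H \<and> (\<forall>p\<in>H. ip p (?g J) = (\<Sum>j\<in>J. a j * p (x j)))"
    using J
  proof induction
    case empty
    have "ip p (\<lambda>x. 0) = 0" if "p \<in> H" for p
      using scale(2)[OF that that that, of 0] sym[OF that zero[OF that that that] that] by simp
    with zero f show ?case by simp
  next
    case (insert i J)
    then have gJ: "?g J \<in> H" and ipJ: "\<And>p. p \<in> H \<Longrightarrow> ip p (?g J) = (\<Sum>j\<in>J. a j * p (x j))"
      by auto
    have Ki: "(\<lambda>z. a i * K z (x i)) \<in> H"
      by (intro scale(1)[OF K K K])
    have "ip p (\<lambda>z. a i * K z (x i) + ?g J z) = a i * p (x i) + (\<Sum>j\<in>J. a j * p (x j))" if "p \<in> H" for p
      using add(2)[OF Ki gJ that] scale(2)[OF K that that] sym[OF that add(1)[OF Ki gJ that] that]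
        sym[OF that gJ that] sym[OF that K that] ipJ[OF that] rep[OF that] by simp
    then show ?case
      using insert.hyps add(1)[OF Ki gJ gJ] by simp
  qed
  have "ip (?g J) (?g J) = (\<Sum>j\<in>J. \<Sum>k\<in>J. a j * a k * K (x j) (x k))"
    using g by (simp add: sum_distrib_left mult.assoc)
  then show ?thesis
    using hilbert_function_space_Cauchy_Schwarz[OF H f, of "?g J"] g f by simp
qed

text \<open>The coefficients of the remainder of the Newton expansion
  \<open>z ^ (2 * N) = (\<Sum>k. (2 * N choose k) * (z - 1) ^ k)\<close> after its terms with \<open>k \<le> N\<close>. The gap
  \<open>N < j < 2 * N\<close> is the point: applied to samples of a function vanishing at the nodes
  \<open>0, \<dots>, N\<close>, these coefficients return its value at the node \<open>2 * N\<close>.\<close>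

lemma newton_remainder_coeffs:
  assumes "N > 0"
  obtains a :: "nat \<Rightarrow> real" where "a (2 * N) = 1" "\<And>j. N < j \<Longrightarrow> j < 2 * N \<Longrightarrow> a j = 0"
    "\<And>z::complex. (\<Sum>j\<le>2*N. of_real (a j) * z ^ j)
      = (\<Sum>k\<in>{N<..2*N}. of_nat (2 * N choose k) * (z - 1) ^ k)"
proof
  \<comment> \<open>The coefficient of \<open>z ^ j\<close> in the Newton terms with
    \<open>k \<le> N\<close>. The factor \<open>k choose j\<close> is 0 for \<open>j > k\<close>, so
    every \<open>k\<close> can share the range \<open>j \<le> N\<close>.\<close>
  define b where "b j = (\<Sum>k\<le>N. real (2 * N choose k) * (real (k choose j) * (- 1) ^ (k - j)))" for j
  define a where "a j = (if j = 2 * N then 1 else if j \<le> N then - b j else 0)" for j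
  show "a (2 * N) = 1" "N < j \<Longrightarrow> j < 2 * N \<Longrightarrow> a j = 0" for j
    by (auto simp: a_def)
  fix z :: complex
  have pow: "(z - 1) ^ k = (\<Sum>j\<le>N. of_nat (k choose j) * (- 1) ^ (k - j) * z ^ j)" if "k \<le> N" for k
  proof -
    have "(z - 1) ^ k = (\<Sum>j\<le>k. of_nat (k choose j) * z ^ j * (- 1) ^ (k - j))"
      using binomial_ring[of z "- 1" k] by simp
    also have "\<dots> = (\<Sum>j\<le>N. of_nat (k choose j) * z ^ j * (- 1) ^ (k - j))"
      using that by (intro sum.mono_neutral_left) auto
    finally show ?thesis by (simp add: mult_ac)
  qed
  have "(\<Sum>k\<le>N. of_nat (2 * N choose k) * (z - 1) ^ k)
      = (\<Sum>k\<le>N. \<Sum>j\<le>N. of_nat (2 * N choose k) * (of_nat (k choose j) * (- 1) ^ (k - j) * z ^ j))"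
    by (simp add: pow sum_distrib_left)
  also have "\<dots> = (\<Sum>j\<le>N. \<Sum>k\<le>N. of_nat (2 * N choose k) * (of_nat (k choose j) * (- 1) ^ (k - j) * z ^ j))"
    by (rule sum.swap)
  also have "\<dots> = (\<Sum>j\<le>N. of_real (b j) * z ^ j)"
    by (simp add: b_def sum_distrib_right mult.assoc)
  finally have low: "(\<Sum>k\<le>N. of_nat (2 * N choose k) * (z - 1) ^ k) = (\<Sum>j\<le>N. of_real (b j) * z ^ j)" .
  have split: "{..2 * N} = {..N} \<union> {N<..2 * N}" "{..N} \<inter> {N<..2 * N} = {}"
    by auto
  have "z ^ (2 * N) = (\<Sum>k\<le>2*N. of_nat (2 * N choose k) * (z - 1) ^ k)"
    using binomial_ring[of "z - 1" 1 "2 * N"] by simp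
  also have "\<dots> = (\<Sum>j\<le>N. of_real (b j) * z ^ j) + (\<Sum>k\<in>{N<..2*N}. of_nat (2 * N choose k) * (z - 1) ^ k)"
    unfolding low[symmetric] split(1) using split(2) by (intro sum.union_disjoint) auto
  finally have z: "z ^ (2 * N) - (\<Sum>j\<le>N. of_real (b j) * z ^ j)
      = (\<Sum>k\<in>{N<..2*N}. of_nat (2 * N choose k) * (z - 1) ^ k)"
    by simp
  have "(\<Sum>j\<le>2*N. of_real (a j) * z ^ j)
      = (\<Sum>j\<le>N. of_real (a j) * z ^ j) + (\<Sum>j\<in>{N<..2*N}. of_real (a j) * z ^ j)"
    unfolding split(1) using split(2) by (intro sum.union_disjoint) auto
  also have "(\<Sum>j\<in>{N<..2*N}. of_real (a j) * z ^ j) = (\<Sum>j\<in>{2*N}. of_real (a j) * z ^ j)"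
    using assms by (intro sum.mono_neutral_right) (auto simp: a_def)
  also have "(\<Sum>j\<le>N. of_real (a j) * z ^ j) = (\<Sum>j\<le>N. - (of_real (b j) * z ^ j))"
    using assms by (intro sum.cong) (auto simp: a_def)
  finally show "(\<Sum>j\<le>2*N. of_real (a j) * z ^ j)
      = (\<Sum>k\<in>{N<..2*N}. of_nat (2 * N choose k) * (z - 1) ^ k)"
    unfolding z[symmetric] by (simp add: a_def sum_negf)
qed

text \<open>Each term is at most \<open>(2 * N * \<bar>\<theta>\<bar>) ^ k / fact k\<close>.
  Doubling the base gains \<open>1 / 2 ^ k\<close>, which is at most \<open>1 / 2 ^ N\<close> on the
  remainder range, and the rest sums to an exponential.\<close>

lemma norm_newton_remainder_cis_le:
  "cmod (\<Sum>k\<in>{N<..2*N}. of_nat (2 * N choose k) * (cis \<theta> - 1) ^ k) \<le> exp (4 * real N * \<bar>\<theta>\<bar>) / 2 ^ N"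
proof -
  have c: "cmod (cis \<theta> - 1) \<le> \<bar>\<theta>\<bar>"
    using iexp_approx1[of \<theta> 0] by (simp add: cis_conv_exp)
  have "cmod (of_nat (2 * N choose k) * (cis \<theta> - 1) ^ k) \<le> (4 * real N * \<bar>\<theta>\<bar>) ^ k / fact k / 2 ^ N"
    if "k \<in> {N<..2*N}" for k
  proof -
    have "real ((2 * N choose k) * fact k) \<le> real ((2 * N) ^ k)"
      by (intro of_nat_mono binomial_fact_pow)
    then have "real (2 * N choose k) \<le> real (2 * N) ^ k / fact k"
      by (simp add: field_simps)
    then have "cmod (of_nat (2 * N choose k) * (cis \<theta> - 1) ^ k) \<le> real (2 * N) ^ k / fact k * \<bar>\<theta>\<bar> ^ k"
      unfolding norm_mult norm_power norm_of_nat by (intro mult_mono power_mono c) auto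
    also have "\<dots> = (4 * real N * \<bar>\<theta>\<bar>) ^ k / fact k / 2 ^ k"
    proof -
      have "(4 * real N * \<bar>\<theta>\<bar>) ^ k = real (2 * N) ^ k * \<bar>\<theta>\<bar> ^ k * 2 ^ k"
        unfolding power_mult_distrib[symmetric] by (rule arg_cong[where f = "\<lambda>t. t ^ k"]) simp
      then show ?thesis by simp
    qed
    also have "\<dots> \<le> (4 * real N * \<bar>\<theta>\<bar>) ^ k / fact k / 2 ^ N"
      using that by (intro divide_left_mono power_increasing) auto
    finally show ?thesis .
  qed
  then have "cmod (\<Sum>k\<in>{N<..2*N}. of_nat (2 * N choose k) * (cis \<theta> - 1) ^ k)
      \<le> (\<Sum>k\<in>{N<..2*N}. (4 * real N * \<bar>\<theta>\<bar>) ^ k / fact k) / 2 ^ N"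
    unfolding sum_divide_distrib by (rule sum_norm_le)
  also have "\<dots> \<le> exp (4 * real N * \<bar>\<theta>\<bar>) / 2 ^ N"
    by (intro divide_right_mono sum_power_div_fact_le_exp) auto
  finally show ?thesis .
qed

text \<open>The admissible step depends only on \<open>c\<close>, not on \<open>f\<close>,
  \<open>x\<close> or \<open>v\<close>, so the conclusion can be iterated along a line.\<close>

lemma native_space_vanishing_step:
  fixes \<Phi> :: "real ^ 'n \<Rightarrow> real" and G :: "real ^ 'n \<Rightarrow> complex"
  assumes FG: "has_fourier_transform (\<lambda>x. complex_of_real (\<Phi> x)) G"
    and cont: "continuous_on UNIV \<Phi>"
    and G: "\<And>\<omega>. cmod (G \<omega>) \<le> C * exp (- c * norm \<omega>)" and c: "c > 0"
    and N: "native_space (\<lambda>x y. \<Phi> (x - y)) H ip" and f: "f \<in> H"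
    and v: "norm v = 1" and z: "\<And>t. t \<ge> 0 \<Longrightarrow> f (x - t *\<^sub>R v) = 0"
    and s: "0 \<le> s" "s \<le> c / 16"
  shows "f (x + s *\<^sub>R v) = 0"
proof -
  \<comment> \<open>Boundedness comes from the one-point case of \<open>native_space_sum_le\<close>
    for the kernel function centred at 0, whose squared norm is \<open>\<Phi> 0\<close>.\<close>
  have "(\<Phi> y)\<^sup>2 \<le> (\<Phi> 0)\<^sup>2" for y
  proof -
    have "(\<lambda>x. \<Phi> (x - 0)) \<in> H" "\<And>f. f \<in> H \<Longrightarrow> ip f (\<lambda>x. \<Phi> (x - 0)) = f 0"
      using N unfolding native_space_def by blast+
    with native_space_sum_le[OF N, of "\<lambda>x. \<Phi> (x - 0)" "{()}" "\<lambda>_. 1" "\<lambda>_. y"] show ?thesis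
      by (simp add: power2_eq_square)
  qed
  then have \<Phi>: "\<bar>\<Phi> y\<bar> \<le> \<bar>\<Phi> 0\<bar>" for y
    by (simp add: abs_le_square_iff)
  define m where "m = (2 * pi) powr (CARD('n) / 2)"
  have m: "m > 0" by (simp add: m_def)
  \<comment> \<open>Half of the decay rate is spent on the growth of the trigonometric polynomial;
    \<open>R\<close> integrates what is left.\<close>
  define R where "R = (LINT \<omega>|lborel. C * exp (- (c / 2) * norm (\<omega> :: real ^ 'n)))"
  have C: "C \<ge> 0"
    using order_trans[OF norm_ge_zero G[of 0]] by simp
  have f0: "ip f f \<ge> 0"
    using hilbert_function_space_ip_nonneg N f unfolding native_space_def by blast
  have key: "(f (x + s *\<^sub>R v))\<^sup>2 \<le> ip f f * (R / m) * (1 / 4) ^ N" if "N > 0" for N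
  proof -
    obtain a where a: "a (2 * N) = 1" "\<And>j. N < j \<Longrightarrow> j < 2 * N \<Longrightarrow> a j = 0"
      "\<And>z::complex. (\<Sum>j\<le>2*N. of_real (a j) * z ^ j)
        = (\<Sum>k\<in>{N<..2*N}. of_nat (2 * N choose k) * (z - 1) ^ k)"
      using newton_remainder_coeffs[OF \<open>N > 0\<close>] by blast
    \<comment> \<open>The nodes run from \<open>x - s *\<^sub>R v\<close> at index 0 through
      \<open>x\<close> at index \<open>N\<close> to \<open>x + s *\<^sub>R v\<close> at index
      \<open>2 * N\<close>, so those with \<open>j \<le> N\<close> lie where \<open>f\<close>
      vanishes.\<close>
    define p where "p j = x + ((real j - N) * (s / N)) *\<^sub>R v" for j
    have p: "p j = x - ((N - real j) * (s / N)) *\<^sub>R v" for j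
    proof -
      have "(real j - N) * (s / N) = - ((N - real j) * (s / N))"
        by (simp only: mult_minus_left[symmetric] minus_diff_eq)
      then show ?thesis by (simp only: p_def scaleR_minus_left diff_conv_add_uminus)
    qed
    have "a j * f (p j) = 0" if "j < 2 * N" for j
    proof (cases "j \<le> N")
      case True
      then have "(N - real j) * (s / N) \<ge> 0" using s by simp
      then show ?thesis unfolding p by (simp add: z)
    qed (simp add: a(2) that)
    then have "(\<Sum>j<2*N. a j * f (p j)) = 0"
      by (intro sum.neutral) auto
    then have "(\<Sum>j\<le>2*N. a j * f (p j)) = f (p (2 * N))"
      using a(1) by (simp flip: lessThan_Suc_atMost)
    also have "p (2 * N) = x + s *\<^sub>R v"
      using \<open>N > 0\<close> by (simp add: p_def)
    finally have "(f (x + s *\<^sub>R v))\<^sup>2 \<le> ip f f * (\<Sum>j\<le>2*N. \<Sum>k\<le>2*N. a j * a k * \<Phi> (p j - p k))"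
      using native_space_sum_le[OF N f, of "{..2*N}" a p] by simp
    also have "\<dots> \<le> ip f f * (R * (1 / 4) ^ N / m)"
    proof (intro mult_left_mono f0)
      let ?P = "\<lambda>\<omega>. \<Sum>j\<le>2*N. of_real (a j) * cis (p j \<bullet> \<omega>)"
      have "m * (\<Sum>j\<le>2*N. \<Sum>k\<le>2*N. a j * a k * \<Phi> (p j - p k))
          \<le> (LINT \<omega>|lborel. C * exp (- c * norm \<omega>) * (cmod (?P \<omega>))\<^sup>2)"
        unfolding m_def by (rule quadratic_form_le_of_fourier_decay[OF FG cont \<Phi> G c])
      also have "\<dots> \<le> (LINT \<omega>|lborel. C * exp (- (c / 2) * norm (\<omega> :: real ^ 'n)) * (1 / 4) ^ N)"
      proof (rule integral_mono)
        show "integrable lborel (\<lambda>\<omega>. C * exp (- c * norm \<omega>) * (cmod (?P \<omega>))\<^sup>2)"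
          by (rule integrable_exp_neg_norm_times_trig_poly) fact
        show "integrable lborel (\<lambda>\<omega> :: real ^ 'n. C * exp (- (c / 2) * norm \<omega>) * (1 / 4) ^ N)"
          using c by (intro integrable_mult_left integrable_mult_right integrable_exp_neg_norm) simp
        fix \<omega> :: "real ^ 'n"
        let ?\<theta> = "s / N * (v \<bullet> \<omega>)"
        \<comment> \<open>Equal spacing makes \<open>?P\<close> a polynomial in
          \<open>cis ?\<theta>\<close>, up to a common phase of modulus 1.\<close>
        have "cis (p j \<bullet> \<omega>) = cis ((x - s *\<^sub>R v) \<bullet> \<omega>) * cis ?\<theta> ^ j" for j
        proof -
          have "p j \<bullet> \<omega> = (x - s *\<^sub>R v) \<bullet> \<omega> + real j * ?\<theta>"
            using \<open>N > 0\<close> by (simp add: p_def inner_diff_left inner_add_left field_simps)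
          then show ?thesis by (simp only: Complex.DeMoivre cis_mult)
        qed
        then have "?P \<omega> = cis ((x - s *\<^sub>R v) \<bullet> \<omega>) * (\<Sum>j\<le>2*N. of_real (a j) * cis ?\<theta> ^ j)"
          by (simp add: sum_distrib_left mult_ac)
        then have "cmod (?P \<omega>) \<le> exp (4 * real N * \<bar>?\<theta>\<bar>) / 2 ^ N"
          unfolding a(3) using norm_newton_remainder_cis_le[of N ?\<theta>] by (simp add: norm_mult)
        \<comment> \<open>Here \<open>N\<close> cancels. The limit \<open>c / 16\<close> on
          \<open>s\<close> gives rate \<open>c / 4\<close>, hence \<open>c / 2\<close> after
          squaring.\<close>
        also have "4 * real N * \<bar>?\<theta>\<bar> \<le> c / 4 * norm \<omega>"
        proof -
          have "4 * real N * \<bar>?\<theta>\<bar> = 4 * s * \<bar>v \<bullet> \<omega>\<bar>"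
            using \<open>N > 0\<close> s by (simp add: abs_mult)
          also have "\<dots> \<le> c / 4 * norm \<omega>"
            using s c v Cauchy_Schwarz_ineq2[of v \<omega>] by (intro mult_mono) auto
          finally show ?thesis .
        qed
        finally have "cmod (?P \<omega>) \<le> exp (c / 4 * norm \<omega>) / 2 ^ N"
          by (simp add: divide_right_mono)
        then have "(cmod (?P \<omega>))\<^sup>2 \<le> (exp (c / 4 * norm \<omega>) / 2 ^ N)\<^sup>2"
          by (intro power_mono) auto
        also have "\<dots> = exp (c / 2 * norm \<omega>) * (1 / 4) ^ N"
          by (simp add: power_divide exp_double[symmetric] power_mult[symmetric] mult.commute[of N])
            (simp add: power_mult)
        finally have "C * exp (- c * norm \<omega>) * (cmod (?P \<omega>))\<^sup>2
            \<le> C * exp (- c * norm \<omega>) * (exp (c / 2 * norm \<omega>) * (1 / 4) ^ N)"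
          using C by (intro mult_left_mono) auto
        also have "\<dots> = C * (exp (- c * norm \<omega>) * exp (c / 2 * norm \<omega>)) * (1 / 4) ^ N"
          by simp
        also have "exp (- c * norm \<omega>) * exp (c / 2 * norm \<omega>) = exp (- (c / 2) * norm \<omega>)"
          unfolding mult_exp_exp by (simp add: field_simps)
        finally show "C * exp (- c * norm \<omega>) * (cmod (?P \<omega>))\<^sup>2
            \<le> C * exp (- (c / 2) * norm \<omega>) * (1 / 4) ^ N" .
      qed
      also have "\<dots> = R * (1 / 4) ^ N"
        by (simp add: R_def)
      finally show "(\<Sum>j\<le>2*N. \<Sum>k\<le>2*N. a j * a k * \<Phi> (p j - p k)) \<le> R * (1 / 4) ^ N / m"
        using m by (simp add: field_simps)
    qed
    finally show ?thesis by simp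
  qed
  \<comment> \<open>The nodes become denser while \<open>s\<close> stays fixed, so the left side of
    \<open>key\<close> is independent of \<open>N\<close>.\<close>
  have "(\<lambda>N. ip f f * (R / m) * (1 / 4) ^ N) \<longlonglongrightarrow> ip f f * (R / m) * 0"
    by (intro tendsto_mult tendsto_const LIMSEQ_power_zero) auto
  then have "(f (x + s *\<^sub>R v))\<^sup>2 \<le> ip f f * (R / m) * 0"
    by (rule LIMSEQ_le_const) (intro exI[of _ 1] allI impI key, simp)
  then show ?thesis by simp
qed

theorem corollary1:
  fixes K :: "real ^ 'n \<Rightarrow> real ^ 'n \<Rightarrow> real"
    and \<Phi> :: "real ^ 'n \<Rightarrow> real"
    and \<Phi>hat :: "real ^ 'n \<Rightarrow> complex"
    and H :: "(real ^ 'n \<Rightarrow> real) set"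
    and ip :: "(real ^ 'n \<Rightarrow> real) \<Rightarrow> (real ^ 'n \<Rightarrow> real) \<Rightarrow> real"
    and C c :: real
  assumes "continuous_on UNIV (\<lambda>(x, y). K x y)"
    and "\<And>x y. K x y = K y x"
    and "positive_definite_kernel K"
    and "\<And>x y. K x y = \<Phi> (x - y)"
    and "has_fourier_transform (\<lambda>x. complex_of_real (\<Phi> x)) \<Phi>hat"
    and "C > 0" and "c > 0"
    and "\<And>\<omega>. cmod (\<Phi>hat \<omega>) \<le> C * exp (- c * norm \<omega>)"
    and "native_space K H ip"
  shows "\<not> (\<exists>f\<in>H. f \<noteq> (\<lambda>x. 0) \<and> compactly_supported f)"
proof clarify
  fix f
  assume f: "f \<in> H" and ne: "f \<noteq> (\<lambda>x. 0)" and "compactly_supported f"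
  then have "bounded (support_on UNIV f)"
    unfolding compactly_supported_def
    using bounded_subset[OF compact_imp_bounded closure_subset] by blast
  then obtain R where R: "\<And>y. f y \<noteq> 0 \<Longrightarrow> norm y \<le> R"
    by (auto simp: bounded_iff support_on_def)
  from ne obtain x0 where x0: "f x0 \<noteq> 0" by auto
  have K: "K = (\<lambda>x y. \<Phi> (x - y))" using assms(4) by auto
  \<comment> \<open>Fixing the second argument at 0 turns continuity of \<open>K\<close> into
    continuity of \<Phi>.\<close>
  have "continuous_on UNIV (\<lambda>x. case (x, 0) of (x, y) \<Rightarrow> K x y)"
    by (rule continuous_on_compose2[OF assms(1)]) (auto intro!: continuous_intros)
  then have cont: "continuous_on UNIV \<Phi>" by (simp add: K)
  \<comment> \<open>Any unit vector serves as direction; \<open>undefined\<close> merely picks some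
    coordinate.\<close>
  define v :: "real ^ 'n" where "v = axis undefined 1"
  have v: "norm v = 1" by (simp add: v_def)
  \<comment> \<open>Beyond \<open>R + norm x0\<close> the line has left the ball containing the
    support; the extra 1 makes the inequality strict.\<close>
  define T where "T = R + norm x0 + 1"
  have far: "f (x0 - t *\<^sub>R v) = 0" if "t \<ge> T" for t
  proof (rule ccontr)
    assume "f (x0 - t *\<^sub>R v) \<noteq> 0"
    then have "norm (x0 - t *\<^sub>R v) \<le> R" by (rule R)
    moreover have "\<bar>t\<bar> = norm (t *\<^sub>R v)" using v by simp
    moreover have "norm (t *\<^sub>R v) \<le> norm x0 + norm (x0 - t *\<^sub>R v)"
      by (metis norm_minus_commute norm_triangle_sub)
    ultimately show False using that unfolding T_def by linarith
  qed
  \<comment> \<open>The vanishing half line grows towards \<open>x0\<close>, which is the parameter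
    0, and reaches it once \<open>n * (c / 16)\<close> exceeds \<open>T\<close>.\<close>
  have "\<forall>t \<ge> T - n * (c / 16). f (x0 - t *\<^sub>R v) = 0" for n :: nat
  proof (induction n)
    case 0
    then show ?case using far by simp
  next
    case (Suc n)
    show ?case
    proof (intro allI impI)
      fix t assume t: "t \<ge> T - Suc n * (c / 16)"
      let ?S = "T - n * (c / 16)"
      show "f (x0 - t *\<^sub>R v) = 0"
      proof (cases "t \<ge> ?S")
        case True
        then show ?thesis using Suc.IH by simp
      next
        case False
        have "f ((x0 - ?S *\<^sub>R v) + (?S - t) *\<^sub>R v) = 0"
        proof (rule native_space_vanishing_step[OF assms(5) cont assms(8) assms(7)
              assms(9)[unfolded K] f v])
          show "f (x0 - ?S *\<^sub>R v - t' *\<^sub>R v) = 0" if "t' \<ge> 0" for t'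
            using Suc.IH[rule_format, of "?S + t'"] that by (simp add: scaleR_add_left diff_diff_add)
          show "0 \<le> ?S - t" using False by simp
          show "?S - t \<le> c / 16" using t by (simp add: field_simps)
        qed
        then show ?thesis by (simp add: scaleR_diff_left)
      qed
    qed
  qed
  moreover obtain n :: nat where "T < n * (c / 16)"
    using reals_Archimedean3[of "c / 16"] assms(7) by auto
  ultimately have "f (x0 - 0 *\<^sub>R v) = 0" by (meson diff_le_0_iff_le less_imp_le)
  with x0 show False by simp
qed

end
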